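(* The total I/O cost (per processor) of the parallel LU factorization algorithm COnfLUX, applied to an $N\times N$ matrix on $P$ processors each with local memory of size $M$, is $$Q_{\mathit{COnfLUX}}=\frac{N^3}{P\sqrt M}+\mathcal O(M).$$
   Context: Setting: a parallel machine with $P$ processors, each with private memory holding $M$ elements, where $N^2/P\le M\le N^2/P^{2/3}$. The I/O cost is the number of elements communicated per processor. Put $P1=N^2/M$ and $c=PM/N^2$; the processors form a 3D grid $[\sqrt{P1},\sqrt{P1},c]$. The block size is $v=a\cdot PM/N^2$ for a small constant $a$ (so $v\ge c$). COnfLUX: Input: $A\in\mathbb R^{N\times N}$. Output: in-place factored $A$ and a row permutation. Set $A_1\leftarrow A$. At step $t=1,\dots,N/v$ the current submatrix $A_t$ is viewed as consisting of: $A_{00}$ ($v\times v$, the first $v$ elements of the current $v$ pivot rows, copied to all processors); $A_{10}$ ($(N-tv)\times v$) and $A_{01}$ ($v\times(N-tv)$), distributed by a 1D decomposition among all processors; $A_{11}$ ($(N-tv)\times(N-tv)$, the Schur complement), distributed by a 2.5D block-cyclic decomposition with partial sums spread over the $c$ layers. Rows are not swapped; pivot rows are only masked. Each step $t$ performs the following, with the indicated per-processor communication cost: 1. Reduce the next block column over the $c$ layers: $\frac{(N-tv)vM}{N^2}$. 2. Find the next $v$ pivots by tournament pivoting, exchanging $v\times v$ blocks in a butterfly pattern among $\sqrt{P1}=N/\sqrt M$ processors, which also yields the factored $A_{00}$: $v^2\lceil\log_2(N/\sqrt M)\rceil$. 3. Send the computed $A_{00}$ and the $v$ pivot row indices to all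 processors: $v^2+v$. 4. Scatter $A_{10}$: $\frac{(N-tv)v}{P}$. 5. Reduce the $v$ pivot rows over the $c$ layers: $\frac{(N-tv)vM}{N^2}$. 6. Scatter $A_{01}$: $\frac{(N-tv)v}{P}$. 7. Local triangular solve updating $A_{10}$ (1D parallel): no communication. 8. Send the data of panel $A_{10}$ needed by each processor: $\frac{(N-tv)Nv}{P\sqrt M}$. 9. Local triangular solve updating $A_{01}$ (1D parallel): no communication. 10. Send the data of panel $A_{01}$ needed by each processor: $\frac{(N-tv)Nv}{P\sqrt M}$. 11. Local update of $A_{11}$ (2.5D parallel): no communication. Then $A_{t+1}$ is $A_t$ restricted to the non-pivot rows and to the columns after the first $v$. The total I/O cost $Q_{\mathit{COnfLUX}}$ is the sum of these costs over all steps $t=1,\dots,N/v$.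
   Formalization: The formal theorem adds the assumption P log P = O(N) (automatic for fixed P); without it the tournament pivoting cost (aPM/N)·⌈log2(N/√M)⌉ is not O(M), e.g. a=1, P=k^6, N=k^5, M=k^6. *)

theory Defs
  imports Complex_Main "HOL-Library.Landau_Symbols"
begin

datatype phase =
    Reduce_Column
  | Tournament_Pivoting
  | Send_A00
  | Scatter_A10
  | Reduce_Pivot_Rows
  | Scatter_A01
  | Solve_A10
  | Send_A10
  | Solve_A01
  | Send_A01
  | Update_A11

lemma UNIV_phase:
  "UNIV = {Reduce_Column, Tournament_Pivoting, Send_A00, Scatter_A10, Reduce_Pivot_Rows,
     Scatter_A01, Solve_A10, Send_A10, Solve_A01, Send_A01, Update_A11}"
  using phase.exhaust by blast

instance phase :: finite
  by standard (simp add: UNIV_phase)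

definition block_size :: "real \<Rightarrow> nat \<Rightarrow> nat \<Rightarrow> nat \<Rightarrow> real" where
  "block_size a N P M = a * real P * real M / (real N)\<^sup>2"

text \<open>
  Number of elements communicated per processor in one phase of step \<open>t\<close>, for block size \<open>v\<close>.
  The processors form a grid with side lengths \<open>N / sqrt M\<close>, \<open>N / sqrt M\<close> and
  \<open>c = P * M / N\<^sup>2\<close>; the tournament takes place among the \<open>N / sqrt M\<close> processors along one side.
\<close>

fun phase_cost :: "real \<Rightarrow> nat \<Rightarrow> nat \<Rightarrow> nat \<Rightarrow> nat \<Rightarrow> phase \<Rightarrow> real" where
  "phase_cost v N P M t Reduce_Column = (real N - real t * v) * v * real M / (real N)\<^sup>2"
| "phase_cost v N P M t Tournament_Pivoting =
     v\<^sup>2 * real_of_int \<lceil>log 2 (real N / sqrt (real M))\<rceil>"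
| "phase_cost v N P M t Send_A00 = v\<^sup>2 + v"
| "phase_cost v N P M t Scatter_A10 = (real N - real t * v) * v / real P"
| "phase_cost v N P M t Reduce_Pivot_Rows = (real N - real t * v) * v * real M / (real N)\<^sup>2"
| "phase_cost v N P M t Scatter_A01 = (real N - real t * v) * v / real P"
| "phase_cost v N P M t Solve_A10 = 0"
| "phase_cost v N P M t Send_A10 =
     (real N - real t * v) * real N * v / (real P * sqrt (real M))"
| "phase_cost v N P M t Solve_A01 = 0"
| "phase_cost v N P M t Send_A01 =
     (real N - real t * v) * real N * v / (real P * sqrt (real M))"
| "phase_cost v N P M t Update_A11 = 0"

definition step_cost :: "real \<Rightarrow> nat \<Rightarrow> nat \<Rightarrow> nat \<Rightarrow> nat \<Rightarrow> real" where
  "step_cost v N P M t = (\<Sum>p\<in>UNIV. phase_cost v N P M t p)"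

text \<open>
  Integrality of the block size and of \<open>N / v\<close> is not required here. The floor has no effect
  when the block size divides \<open>N\<close>.
\<close>

definition Q_COnfLUX :: "real \<Rightarrow> nat \<Rightarrow> nat \<Rightarrow> nat \<Rightarrow> real" where
  "Q_COnfLUX a N P M =
     (let v = block_size a N P M in \<Sum>t = 1..nat \<lfloor>real N / v\<rfloor>. step_cost v N P M t)"

definition admissible :: "nat \<Rightarrow> nat \<Rightarrow> nat \<Rightarrow> bool" where
  "admissible N P M \<longleftrightarrow> N \<ge> 1 \<and> P \<ge> 1 \<and>
     (real N)\<^sup>2 / real P \<le> real M \<and> real M \<le> (real N)\<^sup>2 / real P powr (2 / 3)"

end

theory Submission
  imports Defs
begin

text \<open>
  Put \<open>v = a * P * M / N\<^sup>2\<close> and \<open>K = \<lfloor>N / v\<rfloor>\<close>. Since \<open>\<Sum>t = 1..K. 2 * (N - t * v) * v\<close> differs from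
  \<open>N\<^sup>2\<close> by \<open>(N - K * v)\<^sup>2 + K * v\<^sup>2 \<le> v\<^sup>2 + N * v\<close>, sending the two panels costs
  \<open>N ^ 3 / (P * sqrt M)\<close> up to \<open>(v\<^sup>2 + N * v) * N / (P * sqrt M) = O(M)\<close>. The reductions and
  scatters cost at most \<open>M + N\<^sup>2 / P \<le> 2 * M\<close>, and the tournaments together with the broadcasts
  of \<open>A00\<close> cost at most \<open>N * v * (log P / 2 + 2) + N\<close>; as \<open>N * v = a * P * M / N\<close>, this is where
  \<open>P * log P = O(N)\<close> is needed.
\<close>

text \<open>Telescoping: with \<open>y = x - t * v\<close>, the term \<open>2 * y * v\<close> equals
  \<open>(y + v)^2 - y^2 - v^2\<close>.\<close>

lemma sum_panel_sizes:
  fixes x v :: real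
  shows "2 * (\<Sum>t = 1..K. (x - real t * v) * v) = x\<^sup>2 - ((x - real K * v)\<^sup>2 + real K * v\<^sup>2)"
  by (induction K) (auto simp: algebra_simps power2_eq_square)

text \<open>The phases whose cost varies with \<open>t\<close> form three pairs of equal cost
  (reductions, scatters, panel transfers); this supplies the factor 2 of the telescoping
  sum.\<close>

lemma step_cost_eq:
  "step_cost v N P M t =
     2 * ((real N - real t * v) * v)
       * (real M / (real N)\<^sup>2 + 1 / real P + real N / (real P * sqrt (real M)))
     + (v\<^sup>2 * (real_of_int \<lceil>log 2 (real N / sqrt (real M))\<rceil> + 1) + v)"
  by (simp add: step_cost_def UNIV_phase algebra_simps add_divide_distrib diff_divide_distrib)

lemma Q_COnfLUX_eq:
  fixes a :: real and N P M :: nat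
  defines "v \<equiv> block_size a N P M"
  defines "K \<equiv> nat \<lfloor>real N / v\<rfloor>"
  shows "Q_COnfLUX a N P M =
     ((real N)\<^sup>2 - ((real N - real K * v)\<^sup>2 + real K * v\<^sup>2))
       * (real M / (real N)\<^sup>2 + 1 / real P + real N / (real P * sqrt (real M)))
     + real K * (v\<^sup>2 * (real_of_int \<lceil>log 2 (real N / sqrt (real M))\<rceil> + 1) + v)"
  unfolding Q_COnfLUX_def Let_def v_def[symmetric] K_def[symmetric] sum_panel_sizes[symmetric]
  by (simp only: step_cost_eq[abs_def] sum.distrib sum_distrib_left sum_distrib_right sum_constant
      card_atLeastAtMost One_nat_def diff_Suc_Suc diff_zero distrib_left)

text \<open>The upper bound on \<open>M\<close> enters through
  \<open>P powr (2 / 3) \<ge> 1\<close>, which gives \<open>M \<le> N^2\<close>; the lower bound is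
  used as \<open>N^2 \<le> P * M\<close>.\<close>

lemma admissible_memory_bounds:
  assumes "admissible N P M"
  shows "real M > 0" "sqrt (real M) \<le> real N"
    and "1 \<le> real N / sqrt (real M)" "real N / sqrt (real M) \<le> sqrt (real P)"
proof -
  have N: "real N \<ge> 1" and P: "real P \<ge> 1" and lo: "(real N)\<^sup>2 / real P \<le> real M"
    and hi: "real M \<le> (real N)\<^sup>2 / real P powr (2 / 3)"
    using assms by (auto simp: admissible_def)
  have "0 < (real N)\<^sup>2 / real P"
    using N P by simp
  with lo show M: "real M > 0"
    by linarith
  have "real P powr (2 / 3) \<ge> 1"
    using P by (simp add: ge_one_powr_ge_zero)
  then have "(real N)\<^sup>2 / real P powr (2 / 3) \<le> (real N)\<^sup>2"
    using mult_left_mono[of 1 "real P powr (2 / 3)" "(real N)\<^sup>2"] by (simp add: divide_le_eq)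
  with hi have "real M \<le> (real N)\<^sup>2"
    by linarith
  then show le: "sqrt (real M) \<le> real N"
    by (simp add: real_le_lsqrt)
  then show "1 \<le> real N / sqrt (real M)"
    using M by simp
  have "(real N)\<^sup>2 \<le> real P * real M"
    using lo P by (simp add: divide_le_eq mult.commute)
  then have "real N \<le> sqrt (real P * real M)"
    by (rule real_le_rsqrt)
  then show "real N / sqrt (real M) \<le> sqrt (real P)"
    using M by (simp add: real_sqrt_mult divide_le_eq)
qed

text \<open>The grid side lies between 1 and \<open>sqrt P\<close>, so its logarithm lies between 0
  and half of \<open>log 2 P\<close>; rounding up adds at most 1.\<close>

lemma admissible_tournament_rounds:
  assumes "admissible N P M"
  shows "0 \<le> real_of_int \<lceil>log 2 (real N / sqrt (real M))\<rceil>"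
    and "real_of_int \<lceil>log 2 (real N / sqrt (real M))\<rceil> \<le> log 2 (real P) / 2 + 1"
proof -
  note b = admissible_memory_bounds[OF assms]
  have P: "real P \<ge> 1"
    using assms by (auto simp: admissible_def)
  have pos: "0 < real N / sqrt (real M)"
    using b(3) by linarith
  then have "0 \<le> log 2 (real N / sqrt (real M))"
    using b(3) by (subst zero_le_log_cancel_iff) auto
  then show "0 \<le> real_of_int \<lceil>log 2 (real N / sqrt (real M))\<rceil>"
    by linarith
  have "log 2 (real N / sqrt (real M)) \<le> log 2 (sqrt (real P))"
    using b(4) pos P by (subst log_le_cancel_iff) auto
  also have "\<dots> = log 2 (real P) / 2"
    using P by (simp add: log_def ln_sqrt)
  finally show "real_of_int \<lceil>log 2 (real N / sqrt (real M))\<rceil> \<le> log 2 (real P) / 2 + 1"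
    by linarith
qed

text \<open>The factor of \<open>M\<close> depends on \<open>a\<close>, \<open>C\<close> and
  \<open>D\<close> alone, so it serves as one O-constant for a whole family of parameters. Its
  summand 2 pays for reductions and scatters, \<open>a^2 * D + a\<close> for the error of the panel
  sum, and the rest for pivoting and the broadcasts of \<open>A00\<close>.\<close>

lemma Q_COnfLUX_deviation_bound:
  fixes N P M :: nat
  assumes a: "a > 0" and adm: "admissible N P M"
    and C: "real P * log 2 (real P) \<le> C * real N" and D: "real P \<le> D * real N"
  shows "\<bar>Q_COnfLUX a N P M - real N ^ 3 / (real P * sqrt (real M))\<bar>
           \<le> (2 + a\<^sup>2 * D + a + a * (C / 2 + 2 * D) + D) * real M"
proof -
  define n p m s where "n = real N" and "p = real P" and "m = real M" and "s = sqrt (real M)"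
  define v where "v = block_size a N P M"
  define K where "K = real (nat \<lfloor>n / v\<rfloor>)"
  define L where "L = real_of_int \<lceil>log 2 (n / s)\<rceil>"
  define S where "S = n\<^sup>2 - ((n - K * v)\<^sup>2 + K * v\<^sup>2)"
  have n: "n \<ge> 1" and p: "p \<ge> 1" and lo: "n\<^sup>2 / p \<le> m"
    using adm by (auto simp: admissible_def n_def p_def m_def)
  have m: "m > 0" "s > 0" "s \<le> n" "s * s = m" "s\<^sup>2 = m"
    using admissible_memory_bounds[OF adm] by (auto simp: n_def m_def s_def)
  have "m \<ge> 1"
    using m(1) by (simp add: m_def)
  then have s1: "s \<ge> 1"
    by (simp add: s_def m_def)
  have C': "p * log 2 p \<le> C * n" and D': "p \<le> D * n"
    using C D by (simp_all add: n_def p_def)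
  have v_eq: "v = a * p * m / n\<^sup>2"
    by (simp add: v_def block_size_def n_def p_def m_def)
  have v: "v > 0"
    using a n p m by (simp add: v_eq)
  have "n / v \<ge> 0"
    using n v by simp
  then have "K \<le> n / v" "n / v < K + 1" "K \<ge> 0"
    unfolding K_def by linarith+
  then have K: "K * v \<le> n" "n < K * v + v" "K \<ge> 0"
    using v by (simp_all add: field_simps)
  have L: "0 \<le> L" "L \<le> log 2 p / 2 + 1"
    using admissible_tournament_rounds[OF adm] by (simp_all add: L_def n_def p_def s_def)

  have Kv2: "K * v\<^sup>2 \<le> n * v"
    using K v by (simp add: power2_eq_square mult.assoc[symmetric])
  have R: "0 \<le> (n - K * v)\<^sup>2 + K * v\<^sup>2" "(n - K * v)\<^sup>2 + K * v\<^sup>2 \<le> v\<^sup>2 + n * v"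
  proof -
    have "(n - K * v)\<^sup>2 \<le> v\<^sup>2"
      using K by (intro power_mono) auto
    then show "(n - K * v)\<^sup>2 + K * v\<^sup>2 \<le> v\<^sup>2 + n * v"
      using Kv2 by linarith
  qed (use K in simp)
  have S: "0 \<le> S" "S \<le> n\<^sup>2"
  proof -
    have "S = K * v * ((n - K * v) + (n - v))"
      by (simp add: S_def power2_eq_square algebra_simps)
    \<comment> \<open>If \<open>v > n\<close>, no step is executed and \<open>K = 0\<close>;
      otherwise both summands in the factorization of \<open>S\<close> are nonnegative.\<close>
    moreover have "K * v = 0 \<or> v \<le> n"
    proof -
      have "v \<le> K * v" if "K \<noteq> 0"
        using that v by (simp add: K_def)
      with K show ?thesis
        by fastforce
    qed
    ultimately show "0 \<le> S"
      using K v by (elim disjE) simp_all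
    show "S \<le> n\<^sup>2"
      using R by (simp add: S_def)
  qed

  have reduce_scatter: "S * (m / n\<^sup>2 + 1 / p) \<le> 2 * m"
  proof -
    have "S * (m / n\<^sup>2 + 1 / p) \<le> n\<^sup>2 * (m / n\<^sup>2 + 1 / p)"
      using S m p by (intro mult_right_mono) auto
    also have "\<dots> = m + n\<^sup>2 / p"
      using n by (simp add: field_simps)
    finally show ?thesis
      using lo by linarith
  qed
  have nv: "n * v = a * m * (p / n)"
    using n by (simp add: v_eq power2_eq_square)
  have pn: "p / n \<le> D"
    using D' n by (simp add: divide_le_eq)
  have panels: "((n - K * v)\<^sup>2 + K * v\<^sup>2) * (n / (p * s)) \<le> (a\<^sup>2 * D + a) * m"
  proof -
    have "((n - K * v)\<^sup>2 + K * v\<^sup>2) * (n / (p * s)) \<le> (v\<^sup>2 + n * v) * (n / (p * s))"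
      using R n p m by (intro mult_right_mono) auto
    \<comment> \<open>Substituting \<open>m = s * s\<close> cancels the root in the denominator and
      leaves \<open>p / n \<le> D\<close> times the ratios \<open>s / n\<close> and
      \<open>1 / n\<close>, both at most 1.\<close>
    also have "\<dots> = a\<^sup>2 * m * (p / n) * (s / n) * (1 / n) + a * s"
      using n p m(2) unfolding v_eq m(4)[symmetric] by (simp add: field_simps power2_eq_square)
    also have "\<dots> \<le> a\<^sup>2 * m * D * 1 * 1 + a * m"
    proof (intro add_mono mult_mono)
      show "s \<le> m"
        using s1 m(4) mult_left_mono[OF s1, of s] by simp
      have "D \<ge> 0"
        using pn p n by (smt (verit) divide_pos_pos)
      then show "0 \<le> a\<^sup>2 * m * D" "0 \<le> a\<^sup>2 * m * D * 1"
        using m by simp_all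
    qed (use a n p m pn in auto)
    finally show ?thesis
      by (simp add: algebra_simps)
  qed
  have pivots: "K * (v\<^sup>2 * (L + 1) + v) \<le> (a * (C / 2 + 2 * D) + D) * m"
  proof -
    have "K * (v\<^sup>2 * (L + 1) + v) = K * v\<^sup>2 * (L + 1) + K * v"
      by (simp add: algebra_simps)
    also have "\<dots> \<le> n * v * (L + 1) + n"
      using Kv2 K L by (intro add_mono mult_right_mono) auto
    also have "\<dots> \<le> n * v * (log 2 p / 2 + 2) + n"
      using L n v by simp
    also have "n * v * (log 2 p / 2 + 2) = a * m * (p * log 2 p / n / 2 + 2 * (p / n))"
      by (simp add: nv algebra_simps)
    also have "\<dots> \<le> a * m * (C / 2 + 2 * D)"
    proof -
      have "p * log 2 p / n \<le> C"
        using C' n by (simp add: divide_le_eq)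
      with pn have "p * log 2 p / n / 2 + 2 * (p / n) \<le> C / 2 + 2 * D"
        by (intro add_mono divide_right_mono mult_left_mono) auto
      then show ?thesis
        using a m by (intro mult_left_mono) auto
    qed
    also have "n \<le> D * m"
    proof -
      \<comment> \<open>The second factor is the lower bound on the memory size, so
        \<open>P = O(N)\<close> turns into \<open>N = O(M)\<close>.\<close>
      have "n = p / n * (n\<^sup>2 / p)"
        using n p by (simp add: power2_eq_square)
      also have "\<dots> \<le> D * m"
        using pn lo n p by (intro mult_mono) (auto intro: order_trans[OF _ pn])
      finally show ?thesis .
    qed
    finally show ?thesis
      by (simp add: algebra_simps)
  qed
  have Q: "Q_COnfLUX a N P M = S * (m / n\<^sup>2 + 1 / p + n / (p * s)) + K * (v\<^sup>2 * (L + 1) + v)"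
    unfolding Q_COnfLUX_eq S_def K_def L_def v_def n_def p_def m_def s_def ..
  \<comment> \<open>The \<open>n^2\<close> inside \<open>S\<close> produces exactly the leading
    term. What remains is a signed sum of three nonnegative quantities, so their upper bounds add up
    to a bound on the absolute value.\<close>
  have "Q_COnfLUX a N P M - n ^ 3 / (p * s)
      = S * (m / n\<^sup>2 + 1 / p) + K * (v\<^sup>2 * (L + 1) + v)
        - ((n - K * v)\<^sup>2 + K * v\<^sup>2) * (n / (p * s))"
    unfolding Q S_def by (simp add: algebra_simps power2_eq_square power3_eq_cube)
  moreover have "0 \<le> S * (m / n\<^sup>2 + 1 / p)" "0 \<le> K * (v\<^sup>2 * (L + 1) + v)"
    "0 \<le> ((n - K * v)\<^sup>2 + K * v\<^sup>2) * (n / (p * s))"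
    using S K L R n p m v by auto
  ultimately have "\<bar>Q_COnfLUX a N P M - n ^ 3 / (p * s)\<bar>
      \<le> 2 * m + (a\<^sup>2 * D + a) * m + (a * (C / 2 + 2 * D) + D) * m"
    using reduce_scatter panels pivots by linarith
  then show ?thesis
    by (simp add: n_def p_def m_def s_def algebra_simps)
qed

text \<open>Three parameters vary jointly while \<open>a\<close> stays fixed, so the O-statement is
  made for an arbitrary family along an arbitrary filter. Since \<open>v = a * c\<close>, the
  condition \<open>a \<ge> 1\<close> expresses \<open>v \<ge> c\<close>.\<close>

theorem lemma10:
  fixes a :: real and N P M :: "'i \<Rightarrow> nat" and F :: "'i filter"
  assumes "a \<ge> 1"
    and "eventually (\<lambda>i. admissible (N i) (P i) (M i)) F"
    and "(\<lambda>i. real (P i) * log 2 (real (P i))) \<in> O[F](\<lambda>i. real (N i))"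
  shows "(\<lambda>i. Q_COnfLUX a (N i) (P i) (M i) - real (N i) ^ 3 / (real (P i) * sqrt (real (M i))))
           \<in> O[F](\<lambda>i. real (M i))"
proof -
  obtain C where C: "\<forall>\<^sub>F i in F. norm (real (P i) * log 2 (real (P i))) \<le> C * norm (real (N i))"
    using assms(3) by (auto elim: landau_o.bigE)
  define D where "D = max 1 C"
  show ?thesis
  proof (rule bigoI, use assms(2) C in eventually_elim)
    fix i
    assume adm: "admissible (N i) (P i) (M i)"
      and "norm (real (P i) * log 2 (real (P i))) \<le> C * norm (real (N i))"
    then have le: "real (P i) * log 2 (real (P i)) \<le> C * real (N i)"
      by (auto simp: abs_le_iff)
    have NP: "1 \<le> N i" "1 \<le> P i"
      using adm by (auto simp: admissible_def)
    have "real (P i) \<le> D * real (N i)"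
    proof (cases "P i = 1")
      case True
      have "1 * 1 \<le> D * real (N i)"
        using NP by (intro mult_mono) (auto simp: D_def)
      with True show ?thesis
        by simp
    next
      case False
      then have "1 \<le> log 2 (real (P i))"
        using NP by (subst one_le_log_cancel_iff) auto
      then have "real (P i) * 1 \<le> real (P i) * log 2 (real (P i))"
        by (intro mult_left_mono) auto
      also have "\<dots> \<le> D * real (N i)"
        by (rule order_trans[OF le]) (auto simp: D_def intro: mult_right_mono)
      finally show ?thesis
        by simp
    qed
    from Q_COnfLUX_deviation_bound[OF _ adm le this, of a] assms(1)
    show "norm (Q_COnfLUX a (N i) (P i) (M i) - real (N i) ^ 3 / (real (P i) * sqrt (real (M i))))
        \<le> (2 + a\<^sup>2 * D + a + a * (C / 2 + 2 * D) + D) * norm (real (M i))"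
      by simp
  qed
qed

end
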